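(* Assume that the sequences $\{a_n,b_n,c_n,d_n\}$, $n\in\mathbb{N}$, are uniformly bounded, i.e. there exists $K\in\mathbb{R}_+$ such that $\max\{|a_n(t)|,|b_n(t)|,|c_n(t)|,|d_n(t)|\}\le K$ for all $n\in\mathbb{N}$ and $t\in\mathbb{R}$, and that $\dot a_1=c_1$. Assume that the vector of linear functionals $\mathcal{U}=\mathcal{U}(t)$ verifies, for every $t\in\mathbb{R}$, $$\mathcal{U}(\mathcal{P})=(e^{x^2t}\mathcal{U}^0)(\mathcal{P})\,E\qquad\text{for all }\mathcal{P}\in\mathbb{P}^2,$$ for some $E=E(t)\in\mathcal{M}_{2\times2}(\mathbb{C})$, where $\mathcal{U}^0=\mathcal{U}(0)$. Then $\{a_n,b_n,c_n,d_n\}$, $n\in\mathbb{N}$, is a solution of $$\begin{cases}\dot a_n=c_n-c_{n-2}\\ \dot b_n=c_na_{n+1}-c_{n-1}a_n+d_n-d_{n-2}\\ \dot c_n=c_n(b_{n+1}-b_n)+d_na_{n+2}-d_{n-1}a_n\\ \dot d_n=d_n(b_{n+2}-b_n)\end{cases}\qquad n\in\mathbb{N}.$$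
   Context: $\mathbb{N}=\{1,2,\dots\}$. The $a_n,b_n,c_n,d_n$ ($n\in\mathbb{N}$) are differentiable functions of $t\in\mathbb{R}$; a dot denotes $d/dt$, and the $t$-dependence is suppressed in the notation. Conventions: $a_1(t)\in\mathbb{R}$; $a_0=b_0=c_0=d_0=0$, $c_{-1}=d_{-1}=0$; and $d_n(t)\ne0$ for all $n\ge1$. For $m\ge0$ put $$A_m=\begin{bmatrix}1&0\\ a_{2m+3}&1\end{bmatrix},\quad B_m=\begin{bmatrix}b_{2m+1}&a_{2m+2}\\ c_{2m+1}&b_{2m+2}\end{bmatrix},\quad C_m=\begin{bmatrix}d_{2m-1}&c_{2m}\\ 0&d_{2m}\end{bmatrix}.$$ Let $\mathbb{P}$ be the space of complex polynomials in $x$, $\mathcal{P}_0(x)=[1\ \ x]^T$, $\mathcal{P}_j(x)=x^{2j}\mathcal{P}_0(x)$, and $\mathbb{P}^2$ the set of column vectors $[p_1\ p_2]^T$, $p_i\in\mathbb{P}$ (every such vector is a finite sum $\sum_j\beta_j\mathcal{P}_j$ with $\beta_j\in\mathcal{M}_{2\times2}(\mathbb{C})$). The vector polynomials $\mathcal{B}_m$ are defined by $\mathcal{B}_{-1}=0_{2\times1}$, $\mathcal{B}_0(x)=[1\ \ x-a_1]^T$ and $x^2\mathcal{B}_m(x)=A_m\mathcal{B}_{m+1}(x)+B_m\mathcal{B}_m(x)+C_m\mathcal{B}_{m-1}(x)$, $m\ge0$. A vector of linear functionals $\mathcal{U}=[u^1\ u^2]^T$ (with $u^1,u^2$ linear functionals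 on $\mathbb{P}$) acts on $\mathcal{P}=[p_1\ p_2]^T\in\mathbb{P}^2$ by $$\mathcal{U}(\mathcal{P})=\begin{bmatrix}\langle u^1,p_1\rangle&\langle u^2,p_1\rangle\\ \langle u^1,p_2\rangle&\langle u^2,p_2\rangle\end{bmatrix},\qquad (x^{k}\mathcal{U})(\mathcal{P})=\mathcal{U}(x^{k}\mathcal{P}).$$ For each $t$, $\mathcal{U}=\mathcal{U}(t)$ denotes the vector of linear functionals that is normalized, i.e. $\mathcal{U}(\mathcal{P}_0)=I_{2\times2}$, and with respect to which $\{\mathcal{B}_m\}$ is left-orthogonal, i.e. $(x^{2k}\mathcal{U})(\mathcal{B}_m)=\Delta_m\delta_{k,m}$ for $k=0,\dots,m$, $m\ge0$, where $\Delta_m=C_m\cdots C_1\Delta_0$ for $m\ge1$ and $\Delta_0$ is a non-singular $2\times2$ matrix. The vector of linear functionals $e^{x^2t}\mathcal{U}^0$ is defined by $(e^{x^2t}\mathcal{U}^0)(\mathcal{P}_j)=\sum_{k=0}^{\infty}\frac{t^k}{k!}\,\mathcal{U}^0(x^{2(j+k)}\mathcal{P}_0)$, extended by linearity with respect to left multiplication by numerical matrices, i.e. $(e^{x^2t}\mathcal{U}^0)(\sum_j\beta_j\mathcal{P}_j)=\sum_j\beta_j(e^{x^2t}\mathcal{U}^0)(\mathcal{P}_j)$. *)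

theory Defs
  imports "HOL-Analysis.Analysis" "HOL-Computational_Algebra.Polynomial"
begin

type_synonym cmat = "complex^2^2"
type_synonym vpoly = "(complex poly)^2"
type_synonym vfunctional = "(complex poly \<Rightarrow> complex)^2"

(* The coefficient families are indexed by int so that the indices 0 and -1 of the boundary
   conventions (and C_0, which involves d_{-1}, c_0, d_0) can be written literally.
   Matrices are listed row by row. *)

definition A_mat :: "(int \<Rightarrow> real \<Rightarrow> complex) \<Rightarrow> real \<Rightarrow> int \<Rightarrow> cmat" where
  "A_mat a t m = vector [vector [1, 0], vector [a (2*m+3) t, 1]]"

definition B_mat :: "(int \<Rightarrow> real \<Rightarrow> complex) \<Rightarrow> (int \<Rightarrow> real \<Rightarrow> complex) \<Rightarrow> (int \<Rightarrow> real \<Rightarrow> complex)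
    \<Rightarrow> real \<Rightarrow> int \<Rightarrow> cmat" where
  "B_mat a b c t m = vector [vector [b (2*m+1) t, a (2*m+2) t], vector [c (2*m+1) t, b (2*m+2) t]]"

definition C_mat :: "(int \<Rightarrow> real \<Rightarrow> complex) \<Rightarrow> (int \<Rightarrow> real \<Rightarrow> complex) \<Rightarrow> real \<Rightarrow> int \<Rightarrow> cmat" where
  "C_mat c d t m = vector [vector [d (2*m-1) t, c (2*m) t], vector [0, d (2*m) t]]"

definition const_mat :: "cmat \<Rightarrow> (complex poly)^2^2" where
  "const_mat M = map_matrix (\<lambda>z. [:z:]) M"

definition P0 :: vpoly where
  "P0 = vector [1, [:0, 1:]]"

definition Pj :: "nat \<Rightarrow> vpoly" where
  "Pj j = monom 1 (2*j) *s P0"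

(* The block recurrence; since A_m is unit lower triangular it determines the sequence uniquely. *)
definition vector_polynomials ::
  "(int \<Rightarrow> real \<Rightarrow> complex) \<Rightarrow> (int \<Rightarrow> real \<Rightarrow> complex) \<Rightarrow> (int \<Rightarrow> real \<Rightarrow> complex) \<Rightarrow>
   (int \<Rightarrow> real \<Rightarrow> complex) \<Rightarrow> real \<Rightarrow> (int \<Rightarrow> vpoly) \<Rightarrow> bool" where
  "vector_polynomials a b c d t \<B> \<longleftrightarrow>
     \<B> (-1) = 0 \<and>
     \<B> 0 = vector [1, [:- a 1 t, 1:]] \<and>
     (\<forall>m\<ge>0. monom 1 2 *s \<B> m =
        const_mat (A_mat a t m) *v \<B> (m+1) + const_mat (B_mat a b c t m) *v \<B> m
          + const_mat (C_mat c d t m) *v \<B> (m-1))"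

definition vector_of_linear_functionals :: "vfunctional \<Rightarrow> bool" where
  "vector_of_linear_functionals U \<longleftrightarrow> (\<forall>l. Vector_Spaces.linear smult (*) (U $ l))"

definition act :: "vfunctional \<Rightarrow> vpoly \<Rightarrow> cmat" where
  "act U P = (\<chi> i l. (U $ l) (P $ i))"

definition xpow_functional :: "nat \<Rightarrow> vfunctional \<Rightarrow> vfunctional" where
  "xpow_functional k U = (\<chi> l. (\<lambda>p. (U $ l) (monom 1 k * p)))"

lemma act_xpow_functional: "act (xpow_functional k U) P = act U (monom 1 k *s P)"
  by (simp add: act_def xpow_functional_def vec_eq_iff)

definition normalized :: "vfunctional \<Rightarrow> bool" where
  "normalized U \<longleftrightarrow> act U P0 = mat 1"

primrec Delta :: "(int \<Rightarrow> real \<Rightarrow> complex) \<Rightarrow> (int \<Rightarrow> real \<Rightarrow> complex) \<Rightarrow> real \<Rightarrow> cmat \<Rightarrow> nat \<Rightarrow> cmat" where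
  "Delta c d t \<Delta>0 0 = \<Delta>0"
| "Delta c d t \<Delta>0 (Suc m) = C_mat c d t (int (Suc m)) ** Delta c d t \<Delta>0 m"

definition left_orthogonal ::
  "(int \<Rightarrow> real \<Rightarrow> complex) \<Rightarrow> (int \<Rightarrow> real \<Rightarrow> complex) \<Rightarrow> real \<Rightarrow> (int \<Rightarrow> vpoly) \<Rightarrow> vfunctional \<Rightarrow> bool" where
  "left_orthogonal c d t \<B> U \<longleftrightarrow>
     (\<exists>\<Delta>0. invertible \<Delta>0 \<and>
        (\<forall>m. \<forall>k\<le>m. act (xpow_functional (2*k) U) (\<B> (int m)) =
           (if k = m then Delta c d t \<Delta>0 m else 0)))"

(* The matrix beta_j in the decomposition P = (SUM j. beta_j * Pj j). *)
definition beta :: "vpoly \<Rightarrow> nat \<Rightarrow> cmat" where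
  "beta P j = vector [vector [coeff (P $ 1) (2*j), coeff (P $ 1) (2*j+1)],
                      vector [coeff (P $ 2) (2*j), coeff (P $ 2) (2*j+1)]]"

(* The value of exp(x^2 t) U on a vector polynomial: the series on each Pj j, extended linearly
   with respect to left multiplication by matrices. *)
definition exp_functional_act :: "real \<Rightarrow> vfunctional \<Rightarrow> vpoly \<Rightarrow> cmat" where
  "exp_functional_act t U P =
     (\<Sum>j | beta P j \<noteq> 0. beta P j ** (\<Sum>k. (t^k / fact k) *\<^sub>R act U (monom 1 (2*(j+k)) *s P0)))"

lemma beta_eq_0_iff:
  "beta P j = 0 \<longleftrightarrow> (\<forall>i. coeff (P $ i) (2*j) = 0 \<and> coeff (P $ i) (2*j+1) = 0)"
  by (auto simp: beta_def vec_eq_iff forall_2)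

lemma finite_beta: "finite {j. beta P j \<noteq> 0}"
proof (rule finite_subset)
  show "{j. beta P j \<noteq> 0} \<subseteq> {..degree (P $ 1) + degree (P $ 2)}"
  proof
    fix j assume "j \<in> {j. beta P j \<noteq> 0}"
    then obtain i where "coeff (P $ i) (2*j) \<noteq> 0 \<or> coeff (P $ i) (2*j+1) \<noteq> 0"
      by (auto simp: beta_eq_0_iff)
    then have "j \<le> degree (P $ i)"
      by (auto dest!: le_degree)
    moreover have "i = 1 \<or> i = 2" by (rule exhaust_2)
    ultimately show "j \<in> {..degree (P $ 1) + degree (P $ 2)}" by auto
  qed
qed simp

lemma beta_Pj: "beta (Pj i) j = (if i = j then mat 1 else 0)"
proof -
  have X: "[:0, 1:] = (monom 1 1 :: complex poly)" by (simp add: monom_altdef)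
  have 1: "Pj i $ 1 = monom 1 (2*i)" by (simp add: Pj_def P0_def)
  have 2: "Pj i $ 2 = monom 1 (2*i+1)" by (simp only: Pj_def P0_def X) (simp add: mult_monom)
  have "2*i+1 \<noteq> 2*j" "2*j+1 \<noteq> 2*i" by presburger+
  then show ?thesis
    by (auto simp: beta_def 1 2 vec_eq_iff forall_2 mat_def)
qed

lemma exp_functional_act_Pj:
  "exp_functional_act t U (Pj j) = (\<Sum>k. (t^k / fact k) *\<^sub>R act U (monom 1 (2*(j+k)) *s P0))"
proof -
  have "(mat 1 :: cmat) \<noteq> 0" by (simp add: vec_eq_iff forall_2 mat_def)
  then have "{i. beta (Pj j) i \<noteq> 0} = {j}" by (auto simp: beta_Pj)
  then show ?thesis by (simp add: exp_functional_act_def beta_Pj)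
qed

lemma beta_decomposition: "P = (\<Sum>j | beta P j \<noteq> 0. const_mat (beta P j) *v Pj j)"
proof -
  have X: "[:0, 1:] = (monom 1 1 :: complex poly)" by (simp add: monom_altdef)
  have comp: "(const_mat (beta P j) *v Pj j) $ i =
      monom (coeff (P $ i) (2*j)) (2*j) + monom (coeff (P $ i) (2*j+1)) (2*j+1)" for i j
    using exhaust_2[of i]
    by (auto simp: const_mat_def matrix_vector_mult_def sum_2 beta_def Pj_def P0_def X
        mult_monom smult_monom simp del: One_nat_def)
  have "coeff (P $ i) n = coeff ((\<Sum>j | beta P j \<noteq> 0. const_mat (beta P j) *v Pj j) $ i) n" for i n
  proof -
    let ?S = "{j. beta P j \<noteq> 0}"
    have idx: "(2*j = n \<or> 2*j+1 = n) \<longleftrightarrow> j = n div 2" for j by presburger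
    have "coeff ((\<Sum>j\<in>?S. const_mat (beta P j) *v Pj j) $ i) n =
        (\<Sum>j\<in>?S. if j = n div 2 then coeff (P $ i) n else 0)"
      unfolding sum_component comp coeff_sum
    proof (rule sum.cong[OF refl])
      fix j
      show "coeff (monom (coeff (P $ i) (2*j)) (2*j) + monom (coeff (P $ i) (2*j+1)) (2*j+1)) n =
          (if j = n div 2 then coeff (P $ i) n else 0)"
        using idx[of j] by (auto simp del: One_nat_def)
    qed
    also have "\<dots> = (if n div 2 \<in> ?S then coeff (P $ i) n else 0)"
      using finite_beta[of P] by simp
    also have "\<dots> = coeff (P $ i) n"
    proof (cases "n div 2 \<in> ?S")
      case False
      then have "coeff (P $ i) (2*(n div 2)) = 0" "coeff (P $ i) (2*(n div 2)+1) = 0"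
        by (auto simp: beta_eq_0_iff)
      moreover have "n = 2*(n div 2) \<or> n = 2*(n div 2)+1" by presburger
      ultimately have "coeff (P $ i) n = 0" by metis
      then show ?thesis by simp
    qed simp
    finally show ?thesis by simp
  qed
  then show ?thesis by (simp only: vec_eq_iff poly_eq_iff) blast
qed

lemma vector_space_complex_poly: "vector_space (smult :: complex \<Rightarrow> _)"
  by unfold_locales (simp_all add: smult_add_left smult_add_right)

lemma linear_functional_iff:
  fixes u :: "complex poly \<Rightarrow> complex"
  shows "Vector_Spaces.linear smult (*) u \<longleftrightarrow>
    (\<forall>p q. u (p + q) = u p + u q) \<and> (\<forall>z p. u (smult z p) = z * u p)"
  using vector_space_complex_poly vector_space_over_itself.vector_space_axioms
  by (auto simp: Vector_Spaces.linear_iff)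

end

theory Submission
  imports Defs
begin

text \<open>Write \<open>V\<^sub>m\<close> for the vector polynomials, \<open>M\<^sub>j = \<U>(\<P>\<^sub>j)\<close> for the moments. By boundedness the
  moments at time 0 grow at most geometrically, so the exponential series can be differentiated;
  together with the normalization \<open>M\<^sub>0 = I\<close> this gives \<open>M\<^sub>j' = M\<^sub>j\<^sub>+\<^sub>1 - M\<^sub>j M\<^sub>1\<close>. Differentiating the
  orthogonality relations, \<open>V\<^sub>m' + C\<^sub>m V\<^sub>m\<^sub>-\<^sub>1 - D\<^sub>m V\<^sub>m\<close> has degree below \<open>m\<close> and is orthogonal to all
  lower powers, hence vanishes, where \<open>D\<^sub>m\<close> is the logarithmic derivative of the leading
  coefficient of \<open>V\<^sub>m\<close>. Differentiating the block recurrence and comparing coefficients of the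
  \<open>V\<^sub>k\<close> yields Lax equations for \<open>A\<^sub>m, B\<^sub>m, C\<^sub>m\<close>. The only nonzero entry of \<open>D\<^sub>m\<close>, at position
  (2,1), is \<open>- c\<^sub>2\<^sub>m\<^sub>+\<^sub>1\<close>: this is the hypothesis on \<open>a\<^sub>1'\<close> for \<open>m = 0\<close>, and it propagates because the
  (2,1) entry of \<open>C\<^sub>m\<close> is constantly 0 and \<open>d\<^sub>n \<noteq> 0\<close>. The entries of the Lax equations are then
  the claimed system.\<close>

section \<open>Calculus of 2-by-2 matrices\<close>

text \<open>Supplies the noncommutative product rule, distributivity over sums, and a constant
  \<open>Q\<close> with \<open>norm (X ** Y) \<le> norm X * norm Y * Q\<close>. In finite dimension
  bilinearity is enough for this.\<close>

interpretation mat: bounded_bilinear "(**) :: cmat \<Rightarrow> cmat \<Rightarrow> cmat"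
proof -
  have "bilinear ((**) :: cmat \<Rightarrow> cmat \<Rightarrow> cmat)"
    by (auto simp: bilinear_def linear_iff matrix_add_ldistrib algebra_simps
        matrix_matrix_mult_def vec_eq_iff sum_2 scaleR_add_right)
  then show "bounded_bilinear ((**) :: cmat \<Rightarrow> cmat \<Rightarrow> cmat)"
    by (simp add: bilinear_conv_bounded_bilinear)
qed

lemma cmat_eq_iff:
  "(X :: cmat) = Y \<longleftrightarrow> X$1$1 = Y$1$1 \<and> X$1$2 = Y$1$2 \<and> X$2$1 = Y$2$1 \<and> X$2$2 = Y$2$2"
  by (auto simp: vec_eq_iff forall_2)

lemma cmat_mult_entry: "((X :: cmat) ** Y) $ i $ j = X$i$1 * Y$1$j + X$i$2 * Y$2$j"
  by (simp add: matrix_matrix_mult_def sum_2)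

lemma invertible_mult_eq_0:
  fixes X L :: cmat
  assumes "invertible L" "X ** L = 0"
  shows "X = 0"
proof -
  obtain L' where "L ** L' = mat 1" using assms(1) by (auto simp: invertible_def)
  then have "X = X ** L ** L'" by (simp flip: matrix_mul_assoc)
  then show ?thesis by (simp add: assms(2) mat.zero_left)
qed

lemma has_vector_derivative_vec:
  fixes f :: "real \<Rightarrow> 'a::euclidean_space ^ 'n"
  assumes "\<And>i. ((\<lambda>t. f t $ i) has_vector_derivative f' $ i) (at t)"
  shows "(f has_vector_derivative f') (at t)"
proof -
  have lin: "bounded_linear (axis i :: 'a \<Rightarrow> 'a ^ 'n)" for i
    by (simp add: linear_conv_bounded_linear[symmetric] linear_iff axis_def vec_eq_iff)
  have expand: "(\<Sum>i\<in>UNIV. axis i (x $ i)) = x" for x :: "'a ^ 'n"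
    by (simp add: vec_eq_iff axis_def if_distrib cong: if_cong)
  have "((\<lambda>t. \<Sum>i\<in>UNIV. axis i (f t $ i)) has_vector_derivative (\<Sum>i\<in>UNIV. axis i (f' $ i))) (at t)"
    by (intro has_vector_derivative_sum bounded_linear.has_vector_derivative[OF lin] assms)
  then show ?thesis by (simp only: expand)
qed

lemma has_vector_derivative_vec_nth:
  "(f has_vector_derivative f') (at t) \<Longrightarrow> ((\<lambda>t. f t $ i) has_vector_derivative f' $ i) (at t)"
  by (rule bounded_linear.has_vector_derivative[OF bounded_linear_vec_nth])

lemma cmat_differentiable:
  fixes X :: "real \<Rightarrow> cmat"
  assumes "(\<lambda>t. X t $ 1 $ 1) differentiable (at t)" "(\<lambda>t. X t $ 1 $ 2) differentiable (at t)"
    "(\<lambda>t. X t $ 2 $ 1) differentiable (at t)" "(\<lambda>t. X t $ 2 $ 2) differentiable (at t)"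
  shows "X differentiable (at t)"
proof -
  have "(\<lambda>t. X t $ i $ j) differentiable (at t)" for i j
    using assms exhaust_2[of i] exhaust_2[of j] by auto
  then have "(X has_vector_derivative (\<chi> i j. vector_derivative (\<lambda>t. X t $ i $ j) (at t))) (at t)"
    by (intro has_vector_derivative_vec) (simp add: vector_derivative_works)
  then show ?thesis by (rule differentiableI_vector)
qed

lemma cmat_differentiable_mult:
  fixes X Y :: "real \<Rightarrow> cmat"
  assumes "X differentiable (at t)" "Y differentiable (at t)"
  shows "(\<lambda>t. X t ** Y t) differentiable (at t)"
  using assms mat.FDERIV unfolding differentiable_def by blast

lemma has_vector_derivative_cmat_mult:
  fixes X Y :: "real \<Rightarrow> cmat"
  assumes "(X has_vector_derivative X') (at t)" "(Y has_vector_derivative Y') (at t)"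
  shows "((\<lambda>t. X t ** Y t) has_vector_derivative X t ** Y' + X' ** Y t) (at t)"
  using mat.has_vector_derivative assms by blast

section \<open>Evolution of the moments\<close>

text \<open>After division by the factorials, geometric growth of \<open>g\<close> gives a power
  series that converges everywhere. Termwise differentiation cancels one factor of each factorial
  and so shifts \<open>g\<close> by one. The complex derivative is then restricted to the real
  line.\<close>

lemma exp_series_has_vector_derivative:
  fixes g :: "nat \<Rightarrow> complex"
  assumes growth: "\<And>k. norm (g k) \<le> N * R ^ k"
  shows "((\<lambda>t. \<Sum>k. (t ^ k / fact k) *\<^sub>R g k) has_vector_derivative
    (\<Sum>k. (t ^ k / fact k) *\<^sub>R g (Suc k))) (at t)"
proof -
  define h where "h = (\<lambda>k. g k / fact k)"
  have "summable (\<lambda>k. h k * z ^ k)" for z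
  proof (rule summable_comparison_test')
    show "summable (\<lambda>k. N * (inverse (fact k) * (R * norm z) ^ k))"
      by (intro summable_mult summable_exp)
    fix k
    have "norm (h k * z ^ k) = norm (g k) * (norm z ^ k / fact k)"
      by (simp add: h_def norm_mult norm_divide norm_power)
    also have "\<dots> \<le> N * R ^ k * (norm z ^ k / fact k)"
      by (intro mult_right_mono growth) simp
    finally show "norm (h k * z ^ k) \<le> N * (inverse (fact k) * (R * norm z) ^ k)"
      by (simp add: field_simps power_mult_distrib)
  qed
  then have "((\<lambda>z. \<Sum>k. h k * z ^ k) has_field_derivative (\<Sum>k. diffs h k * of_real t ^ k))
      (at (of_real t))"
    by (rule termdiffs_strong_converges_everywhere)
  then have "((\<lambda>s. \<Sum>k. h k * of_real s ^ k) has_vector_derivative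
      (\<Sum>k. diffs h k * of_real t ^ k)) (at t)"
    by (rule has_vector_derivative_real_field)
  moreover have "h k * of_real s ^ k = (s ^ k / fact k) *\<^sub>R g k" for k s
    by (simp add: h_def scaleR_conv_of_real)
  moreover have "diffs h k * of_real s ^ k = (s ^ k / fact k) *\<^sub>R g (Suc k)" for k s
    by (simp add: h_def diffs_def scaleR_conv_of_real fact_Suc del: of_nat_Suc)
  ultimately show ?thesis by simp
qed

text \<open>Reduced to scalar series entry by entry. Summability of the matrix series allows the
  entries, which are bounded linear, to be taken inside the infinite sum.\<close>

lemma exp_series_cmat_has_vector_derivative:
  fixes m :: "nat \<Rightarrow> cmat"
  assumes growth: "\<And>k. norm (m k) \<le> N * R ^ k"
  shows "((\<lambda>t. \<Sum>k. (t ^ k / fact k) *\<^sub>R m (j + k)) has_vector_derivative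
    (\<Sum>k. (t ^ k / fact k) *\<^sub>R m (Suc j + k))) (at t)"
proof -
  have summ: "summable (\<lambda>k. (s ^ k / fact k) *\<^sub>R m (n + k))" for s n
  proof (rule summable_comparison_test')
    show "summable (\<lambda>k. N * R ^ n * (inverse (fact k) * (R * \<bar>s\<bar>) ^ k))"
      by (intro summable_mult summable_exp)
    fix k
    have "norm ((s ^ k / fact k) *\<^sub>R m (n + k)) = norm (m (n + k)) * (\<bar>s\<bar> ^ k / fact k)"
      by (simp add: power_abs)
    also have "\<dots> \<le> N * R ^ (n + k) * (\<bar>s\<bar> ^ k / fact k)"
      by (intro mult_right_mono growth) simp
    finally show "norm ((s ^ k / fact k) *\<^sub>R m (n + k)) \<le>
        N * R ^ n * (inverse (fact k) * (R * \<bar>s\<bar>) ^ k)"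
      by (simp add: field_simps power_mult_distrib power_add)
  qed
  have entry: "(\<Sum>k. (s ^ k / fact k) *\<^sub>R m (n + k)) $ i $ l =
      (\<Sum>k. (s ^ k / fact k) *\<^sub>R (m (n + k) $ i $ l))" for s n i l
  proof -
    have "bounded_linear (\<lambda>X :: cmat. X $ i $ l)"
      by (intro bounded_linear_compose[OF bounded_linear_vec_nth bounded_linear_vec_nth])
    from bounded_linear.suminf[OF this summ] show ?thesis by simp
  qed
  have "((\<lambda>t. \<Sum>k. (t ^ k / fact k) *\<^sub>R (m (j + k) $ i $ l)) has_vector_derivative
    (\<Sum>k. (t ^ k / fact k) *\<^sub>R (m (j + Suc k) $ i $ l))) (at t)" for i l
  proof (rule exp_series_has_vector_derivative)
    fix k
    have "norm (m (j + k) $ i $ l) \<le> norm (m (j + k))"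
      by (meson Finite_Cartesian_Product.norm_nth_le order_trans)
    also have "\<dots> \<le> (N * R ^ j) * R ^ k"
      using growth[of "j + k"] by (simp add: power_add algebra_simps)
    finally show "norm (m (j + k) $ i $ l) \<le> (N * R ^ j) * R ^ k" .
  qed
  then show ?thesis
    by (intro has_vector_derivative_vec) (simp only: entry, simp)
qed

text \<open>The moments satisfy \<open>M\<^sub>j S\<^sub>0 = S\<^sub>j\<close>, where \<open>S\<^sub>j\<close> are the exponential series and
  \<open>S\<^sub>0\<close> is inverse to \<open>E\<close>; so \<open>E\<close> itself never has to be differentiated.\<close>

lemma moments_has_vector_derivative:
  fixes M :: "nat \<Rightarrow> real \<Rightarrow> cmat"
  assumes growth: "\<And>k. norm (M k 0) \<le> N * R ^ k"
    and diff: "\<And>k t. M k differentiable (at t)"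
    and M0: "\<And>t. M 0 t = mat 1"
    and exp_rep: "\<And>t. \<exists>E. \<forall>j. M j t = (\<Sum>k. (t ^ k / fact k) *\<^sub>R M (j + k) 0) ** E"
  shows "(M j has_vector_derivative M (Suc j) t - M j t ** M 1 t) (at t)"
proof -
  define S where "S = (\<lambda>j t. \<Sum>k. (t ^ k / fact k) *\<^sub>R M (j + k) 0)"
  have S': "(S i has_vector_derivative S (Suc i) t) (at t)" for i t
    unfolding S_def using exp_series_cmat_has_vector_derivative[OF growth] .
  have "\<forall>t. \<exists>E. \<forall>j. M j t = S j t ** E"
    unfolding S_def using exp_rep by blast
  then obtain E where E: "\<And>j t. M j t = S j t ** E t"
    unfolding choice_iff by blast
  have SE: "S 0 t ** E t = mat 1" for t
    using E[of 0 t] M0[of t] by simp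
  then have ES: "E t ** S 0 t = mat 1" for t
    by (simp only: matrix_left_right_inverse)
  have MS: "M i t ** S 0 t = S i t" for i t
    by (simp only: E ES matrix_mul_assoc[symmetric] matrix_mul_rid)
  define M' where "M' = vector_derivative (M j) (at t)"
  have M': "(M j has_vector_derivative M') (at t)"
    unfolding M'_def using diff vector_derivative_works by blast
  \<comment> \<open>Differentiate \<open>M j ** S 0 = S j\<close>. Right multiplication by
    \<open>E\<close> then turns \<open>S 0\<close>, \<open>S 1\<close> and \<open>S (Suc j)\<close>
    into the identity, \<open>M 1\<close> and \<open>M (Suc j)\<close>.\<close>
  have "((\<lambda>t. M j t ** S 0 t) has_vector_derivative M j t ** S (Suc 0) t + M' ** S 0 t) (at t)"
    by (intro has_vector_derivative_cmat_mult M' S')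
  then have "M j t ** S (Suc 0) t + M' ** S 0 t = S (Suc j) t"
    unfolding MS using S' vector_derivative_unique_at by blast
  then have "(M j t ** S (Suc 0) t + M' ** S 0 t) ** E t = S (Suc j) t ** E t"
    by simp
  then have "M j t ** M 1 t + M' = M (Suc j) t"
    by (simp only: mat.add_left matrix_mul_assoc[symmetric] E[symmetric] M0 matrix_mul_rid One_nat_def)
  then have "M' = M (Suc j) t - M j t ** M 1 t"
    unfolding eq_diff_eq by (simp only: add.commute)
  with M' show ?thesis by (simp only:)
qed

section \<open>Lax equations for the block coefficients\<close>

text \<open>Induction on the degree bound. In the step, \<open>X\<close> is chosen so that
  subtracting \<open>X\<close> times the \<open>m\<close>-th polynomial cancels the top coefficient
  of \<open>w\<close>. The remainder vanishes by induction, and testing \<open>w\<close> at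
  \<open>k = m\<close> leaves \<open>X ** \<Delta> m = 0\<close>, hence
  \<open>X = 0\<close>.\<close>

lemma left_orthogonal_unique:
  fixes v :: "nat \<Rightarrow> nat \<Rightarrow> cmat" and M \<Delta> w :: "nat \<Rightarrow> cmat"
  assumes orth: "\<And>m k. k \<le> m \<Longrightarrow> (\<Sum>j\<le>m. v m j ** M (j + k)) = (if k = m then \<Delta> m else 0)"
    and vanish: "\<And>m j. m < j \<Longrightarrow> v m j = 0"
    and lead: "\<And>m. invertible (v m m)"
    and inv_\<Delta>: "\<And>m. invertible (\<Delta> m)"
    and w_vanish: "\<And>j. m \<le> j \<Longrightarrow> w j = 0"
    and w_orth: "\<And>k. k < m \<Longrightarrow> (\<Sum>j<m. w j ** M (j + k)) = 0"
  shows "w j = 0"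
  using w_vanish w_orth
proof (induction m arbitrary: w j)
  case (Suc m)
  obtain L where L: "L ** v m m = mat 1"
    using lead[of m] by (auto simp: invertible_def)
  define X where "X = w m ** L"
  define w' where "w' = (\<lambda>j. w j - X ** v m j)"
  have w'_vanish: "w' j = 0" if "m \<le> j" for j
  proof (cases "j = m")
    case True
    then show ?thesis by (simp add: w'_def X_def L flip: matrix_mul_assoc)
  next
    case False
    with that show ?thesis by (simp add: w'_def Suc.prems(1) vanish mat.zero_right)
  qed
  have sum_w': "(\<Sum>j<m. w' j ** M (j + k)) =
      (\<Sum>j<Suc m. w j ** M (j + k)) - X ** (\<Sum>j\<le>m. v m j ** M (j + k))" for k
  proof -
    have "(\<Sum>j<m. w' j ** M (j + k)) = (\<Sum>j<Suc m. w' j ** M (j + k))"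
      by (simp add: w'_vanish mat.zero_left)
    also have "\<dots> = (\<Sum>j<Suc m. w j ** M (j + k)) - (\<Sum>j<Suc m. X ** (v m j ** M (j + k)))"
      by (simp only: w'_def mat.diff_left sum_subtractf matrix_mul_assoc)
    finally show ?thesis by (simp only: mat.sum_right lessThan_Suc_atMost)
  qed
  have "w' j = 0" for j
  proof (rule Suc.IH)
    fix k assume "k < m"
    then show "(\<Sum>j<m. w' j ** M (j + k)) = 0"
      using Suc.prems(2)[of k] orth[of k m] by (simp only: sum_w') (simp add: mat.zero_right)
  qed (rule w'_vanish)
  moreover from this have "X ** \<Delta> m = 0"
    using sum_w'[of m] Suc.prems(2)[of m] orth[of m m] by (simp add: mat.zero_left)
  then have "X = 0" by (rule invertible_mult_eq_0[OF inv_\<Delta>])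
  ultimately show ?case by (metis w'_def mat.zero_left diff_zero)
qed simp

text \<open>\<open>v m j\<close> is the coefficient of the \<open>m\<close>-th vector polynomial at \<open>\<P>\<^sub>j\<close>. Truncated
  subtraction makes \<open>v (m - 1)\<close> meaningless for \<open>m = 0\<close>, where it is always multiplied by
  \<open>C 0 = 0\<close>.\<close>

locale block_recurrence =
  fixes A Ainv B C :: "nat \<Rightarrow> real \<Rightarrow> cmat"
    and v :: "nat \<Rightarrow> nat \<Rightarrow> real \<Rightarrow> cmat"
  assumes A_diff: "A m differentiable (at t)"
    and Ainv_diff: "Ainv m differentiable (at t)"
    and B_diff: "B m differentiable (at t)"
    and C_diff: "C m differentiable (at t)"
    and Ainv: "Ainv m t ** A m t = mat 1"
    and C_0: "C 0 t = 0"
    and v_rec: "(case j of 0 \<Rightarrow> 0 | Suc i \<Rightarrow> v m i t) =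
      A m t ** v (Suc m) j t + B m t ** v m j t + C m t ** v (m - 1) j t"
    and v_0_diff: "v 0 0 differentiable (at t)"
    and v_0_0: "invertible (v 0 0 t)"
    and v_0_Suc: "v 0 (Suc j) t = 0"
begin

text \<open>Inverting \<open>A m\<close> makes the recurrence explicit for the next polynomial. The
  degree bound, the leading coefficients and differentiability are all obtained from it by
  induction.\<close>

lemma v_Suc:
  "v (Suc m) j t = Ainv m t **
     ((case j of 0 \<Rightarrow> 0 | Suc i \<Rightarrow> v m i t) - B m t ** v m j t - C m t ** v (m - 1) j t)"
  unfolding v_rec by (simp add: matrix_mul_assoc Ainv)

lemma v_vanish: "m < j \<Longrightarrow> v m j t = 0"
proof (induction m arbitrary: j rule: less_induct)
  case (less m)
  show ?case
  proof (cases m)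
    case 0
    with less.prems show ?thesis using v_0_Suc by (cases j) auto
  next
    case (Suc n)
    with less.prems obtain i where i: "j = Suc i" "n < i" by (cases j) auto
    then have "v n i t = 0" "v n j t = 0" "v (n - 1) j t = 0"
      using less.IH[of n] less.IH[of "n - 1"] Suc by auto
    then show ?thesis unfolding Suc v_Suc by (simp add: i mat.zero_right)
  qed
qed

lemma v_lead_Suc: "v (Suc m) (Suc m) t = Ainv m t ** v m m t"
  unfolding v_Suc by (simp add: v_vanish mat.zero_right)

lemma v_lead_invertible: "invertible (v m m t)"
proof (induction m)
  case (Suc m)
  have "invertible (Ainv m t)"
    using Ainv matrix_left_right_inverse unfolding invertible_def by blast
  with Suc show ?case unfolding v_lead_Suc by (intro invertible_mult)
qed (rule v_0_0)

lemma v_diff: "v m j differentiable (at t)"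
proof (induction m arbitrary: j rule: less_induct)
  case (less m)
  show ?case
  proof (cases m)
    case 0
    then show ?thesis using v_0_diff v_0_Suc by (cases j) (auto simp: fun_eq_iff[symmetric])
  next
    case (Suc n)
    have "(\<lambda>t. case j of 0 \<Rightarrow> 0 | Suc i \<Rightarrow> v n i t) differentiable (at t)"
      using less.IH[of n] Suc by (cases j) auto
    moreover have "v n j differentiable (at t)" "v (n - 1) j differentiable (at t)"
      using less.IH[of n] less.IH[of "n - 1"] Suc by auto
    ultimately have "(\<lambda>t. Ainv n t ** ((case j of 0 \<Rightarrow> 0 | Suc i \<Rightarrow> v n i t) - B n t ** v n j t
        - C n t ** v (n - 1) j t)) differentiable (at t)"
      by (intro cmat_differentiable_mult differentiable_diff Ainv_diff B_diff C_diff)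
    then show ?thesis by (simp only: Suc v_Suc[abs_def])
  qed
qed

end

locale moment_flow = block_recurrence A Ainv B C v
  for A Ainv B C :: "nat \<Rightarrow> real \<Rightarrow> cmat" and v +
  fixes M \<Delta> :: "nat \<Rightarrow> real \<Rightarrow> cmat"
  assumes orth: "k \<le> m \<Longrightarrow> (\<Sum>j\<le>m. v m j t ** M (j + k) t) = (if k = m then \<Delta> m t else 0)"
    and \<Delta>_0: "invertible (\<Delta> 0 t)"
    and \<Delta>_Suc: "\<Delta> (Suc m) t = C (Suc m) t ** \<Delta> m t"
    and C_inv: "invertible (C (Suc m) t)"
    and M_deriv: "(M j has_vector_derivative M (Suc j) t - M j t ** M 1 t) (at t)"
begin

lemma \<Delta>_invertible: "invertible (\<Delta> m t)"
  by (induction m) (auto simp: \<Delta>_0 \<Delta>_Suc intro: invertible_mult C_inv)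

definition D :: "nat \<Rightarrow> real \<Rightarrow> cmat" where
  "D m t = vector_derivative (v m m) (at t) ** matrix_inv (v m m t)"

lemma D_v_lead: "D m t ** v m m t = vector_derivative (v m m) (at t)"
proof -
  have "matrix_inv (v m m t) ** v m m t = mat 1"
    using v_lead_invertible[of m t] unfolding invertible_def matrix_inv_def by (rule someI2_ex) blast
  then show ?thesis by (simp only: D_def matrix_mul_assoc[symmetric] matrix_mul_rid)
qed

text \<open>The difference of the two sides is orthogonal to all \<open>x\<^bsup>2k\<^esup>\<close>, \<open>k < m\<close>, and has no
  coefficients from \<open>\<P>\<^sub>m\<close> on.\<close>

lemma v_deriv:
  "(v m j has_vector_derivative D m t ** v m j t - C m t ** v (m - 1) j t) (at t)"
proof -
  define v' where "v' = (\<lambda>j. vector_derivative (v m j) (at t))"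
  have v': "(v m j has_vector_derivative v' j) (at t)" for j
    unfolding v'_def using v_diff vector_derivative_works by blast
  have v'_vanish: "v' j = 0" if "m < j" for j
  proof -
    have "v m j = (\<lambda>t. 0)" using that v_vanish by auto
    then show ?thesis by (simp add: v'_def)
  qed
  define w where "w = (\<lambda>j. v' j - (D m t ** v m j t - C m t ** v (m - 1) j t))"
  \<comment> \<open>For positive \<open>m\<close> this is the degree bound for index
    \<open>m - 1\<close>. For \<open>m = 0\<close> the truncated index is again 0, and
    \<open>C 0 = 0\<close> is what helps.\<close>
  have C_vanish: "C m t ** v (m - 1) j t = 0" if "m \<le> j" for j
    using that by (cases m) (auto simp: C_0 v_vanish mat.zero_left mat.zero_right)
  have w_vanish: "w j = 0" if "m \<le> j" for j
  proof (cases "j = m")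
    case True
    then show ?thesis using C_vanish[of j] by (simp add: w_def v'_def D_v_lead)
  next
    case False
    with that show ?thesis using C_vanish[of j] by (simp add: w_def v'_vanish v_vanish mat.zero_right)
  qed
  have w_orth: "(\<Sum>j<m. w j ** M (j + k) t) = 0" if "k < m" for k
  proof -
    obtain n where n: "m = Suc n" using \<open>k < m\<close> by (cases m) auto
    have w_n: "w j = v' j - D m t ** v m j t + C m t ** v n j t" for j
      by (simp add: w_def n)
    \<comment> \<open>Differentiate a vanishing orthogonality relation. By the moment flow, the
      derivative of \<open>M\<close> contributes the relation for \<open>Suc k\<close> minus the one
      for \<open>k\<close> times \<open>M 1\<close>; the latter is zero.\<close>
    have "((\<lambda>t. \<Sum>j\<le>m. v m j t ** M (j + k) t) has_vector_derivative
        (\<Sum>j\<le>m. v m j t ** (M (Suc (j + k)) t - M (j + k) t ** M 1 t) + v' j ** M (j + k) t)) (at t)"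
      by (intro has_vector_derivative_sum has_vector_derivative_cmat_mult v' M_deriv)
    moreover have "(\<lambda>t. \<Sum>j\<le>m. v m j t ** M (j + k) t) = (\<lambda>t. 0)"
      using orth[of k m] that by auto
    ultimately have "(\<Sum>j\<le>m. v m j t ** (M (Suc (j + k)) t - M (j + k) t ** M 1 t)
        + v' j ** M (j + k) t) = 0"
      by (simp only: vector_derivative_unique_at[OF _ has_vector_derivative_const])
    then have "(\<Sum>j\<le>m. v m j t ** M (j + Suc k) t) - (\<Sum>j\<le>m. v m j t ** M (j + k) t) ** M 1 t
        + (\<Sum>j\<le>m. v' j ** M (j + k) t) = 0"
      by (simp only: mat.diff_right sum.distrib sum_subtractf mat.sum_left matrix_mul_assoc add_Suc_right)
    then have v'_sum: "(\<Sum>j\<le>m. v' j ** M (j + k) t) = - (if Suc k = m then \<Delta> m t else 0)"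
      using orth[of "Suc k" m t] orth[of k m t] that
      by (simp add: mat.zero_left eq_neg_iff_add_eq_0 add.commute)
    have "(\<Sum>j<m. w j ** M (j + k) t) = (\<Sum>j\<le>m. w j ** M (j + k) t)"
      by (simp add: lessThan_Suc_atMost[symmetric] w_vanish mat.zero_left)
    also have "\<dots> = (\<Sum>j\<le>m. v' j ** M (j + k) t) - D m t ** (\<Sum>j\<le>m. v m j t ** M (j + k) t)
        + C m t ** (\<Sum>j\<le>m. v n j t ** M (j + k) t)"
      by (simp only: w_n mat.add_left mat.diff_left sum_subtractf sum.distrib mat.sum_right matrix_mul_assoc)
    also have "(\<Sum>j\<le>m. v n j t ** M (j + k) t) = (\<Sum>j\<le>n. v n j t ** M (j + k) t)"
      by (simp add: n v_vanish mat.zero_left)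
    also have "\<dots> = (if k = n then \<Delta> n t else 0)"
      using orth[of k n t] that n by simp
    finally have "(\<Sum>j<m. w j ** M (j + k) t) = - (if Suc k = m then \<Delta> m t else 0) - D m t ** 0
        + C m t ** (if k = n then \<Delta> n t else 0)"
      using orth[of k m t] that by (simp only: v'_sum) simp
    \<comment> \<open>For \<open>k = n\<close> the terms \<open>- \<Delta> m\<close> and
      \<open>C m ** \<Delta> n\<close> cancel by the recursion for \<open>\<Delta>\<close>; for
      smaller \<open>k\<close> both are absent.\<close>
    then show ?thesis by (simp only: n \<Delta>_Suc) (simp add: mat.zero_right)
  qed
  have "w j = 0"
    by (rule left_orthogonal_unique[where v = "\<lambda>m j. v m j t" and M = "\<lambda>j. M j t" and \<Delta> = "\<lambda>m. \<Delta> m t",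
          OF orth v_vanish v_lead_invertible \<Delta>_invertible w_vanish w_orth])
  then show ?thesis using v'[of j] by (simp add: w_def)
qed

text \<open>The coefficient \<open>?u m\<close> of \<open>x^2\<close> times the \<open>m\<close>-th
  polynomial is differentiated twice: directly by \<open>v_deriv\<close>, and through the recurrence
  by the product rule. Expanding \<open>?u m\<close> and \<open>?u (m - 1)\<close> again by the
  recurrence, the terms with \<open>v (m - 1 - 1)\<close> cancel.\<close>

lemma lax_relation:
  fixes A' B' C' :: cmat
  assumes A': "(A m has_vector_derivative A') (at t)"
    and B': "(B m has_vector_derivative B') (at t)"
    and C': "(C m has_vector_derivative C') (at t)"
  shows "(A' + A m t ** D (Suc m) t - D m t ** A m t) ** v (Suc m) j t
    + (B' + B m t ** D m t - D m t ** B m t - A m t ** C (Suc m) t + C m t ** A (m - 1) t) ** v m j t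
    + (C' + C m t ** D (m - 1) t - D m t ** C m t - B m t ** C m t + C m t ** B (m - 1) t) ** v (m - 1) j t
    = 0" (is "?lhs = 0")
proof -
  let ?u = "\<lambda>m t. case j of 0 \<Rightarrow> 0 | Suc i \<Rightarrow> v m i t"
  have "(?u m has_vector_derivative D m t ** ?u m t - C m t ** ?u (m - 1) t) (at t)"
  proof (cases j)
    case (Suc i)
    then show ?thesis using v_deriv[of m i t] by simp
  qed (simp add: mat.zero_right)
  moreover have "(?u m has_vector_derivative
      (A m t ** (D (Suc m) t ** v (Suc m) j t - C (Suc m) t ** v m j t) + A' ** v (Suc m) j t)
    + (B m t ** (D m t ** v m j t - C m t ** v (m - 1) j t) + B' ** v m j t)
    + (C m t ** (D (m - 1) t ** v (m - 1) j t - C (m - 1) t ** v (m - 1 - 1) j t) + C' ** v (m - 1) j t))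
    (at t)"
    unfolding v_rec using v_deriv[of "Suc m" j t]
    by (intro has_vector_derivative_add has_vector_derivative_cmat_mult A' B' C' v_deriv) simp
  ultimately have "D m t ** ?u m t - C m t ** ?u (m - 1) t =
      (A m t ** (D (Suc m) t ** v (Suc m) j t - C (Suc m) t ** v m j t) + A' ** v (Suc m) j t)
    + (B m t ** (D m t ** v m j t - C m t ** v (m - 1) j t) + B' ** v m j t)
    + (C m t ** (D (m - 1) t ** v (m - 1) j t - C (m - 1) t ** v (m - 1 - 1) j t) + C' ** v (m - 1) j t)"
    by (rule vector_derivative_unique_at)
  \<comment> \<open>The factor \<open>C m\<close> matters: for \<open>m = 0\<close> the recurrence
    at the truncated index would yield \<open>v 1\<close> instead of \<open>v 0\<close>, but both
    sides vanish because \<open>C 0 = 0\<close>.\<close>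
  moreover have "C m t ** ?u (m - 1) t = C m t **
      (A (m - 1) t ** v m j t + B (m - 1) t ** v (m - 1) j t + C (m - 1) t ** v (m - 1 - 1) j t)"
    unfolding v_rec[where j = j and m = "m - 1"] by (cases m) (simp_all add: C_0 mat.zero_left)
  ultimately show ?thesis
    unfolding v_rec[where j = j and m = m]
    by (simp only: mat.add_left mat.add_right mat.diff_left mat.diff_right matrix_mul_assoc)
      (simp add: algebra_simps)
qed

text \<open>The three brackets of \<open>lax_relation\<close> are killed one after another by taking
  \<open>j = m + 1\<close>, \<open>m\<close>, \<open>m - 1\<close>: by the degree bound only one
  unknown bracket survives each time, and it multiplies an invertible leading coefficient.\<close>

lemma lax:
  shows A_lax: "(A m has_vector_derivative D m t ** A m t - A m t ** D (Suc m) t) (at t)"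
    and B_lax: "(B m has_vector_derivative D m t ** B m t - B m t ** D m t
      + A m t ** C (Suc m) t - C m t ** A (m - 1) t) (at t)"
    and C_lax: "(C m has_vector_derivative D m t ** C m t - C m t ** D (m - 1) t
      + B m t ** C m t - C m t ** B (m - 1) t) (at t)"
proof -
  define A' where "A' = vector_derivative (A m) (at t)"
  define B' where "B' = vector_derivative (B m) (at t)"
  define C' where "C' = vector_derivative (C m) (at t)"
  have A': "(A m has_vector_derivative A') (at t)" and B': "(B m has_vector_derivative B') (at t)"
    and C': "(C m has_vector_derivative C') (at t)"
    unfolding A'_def B'_def C'_def using A_diff B_diff C_diff vector_derivative_works by blast+
  define X where "X = A' + A m t ** D (Suc m) t - D m t ** A m t"
  define Y where "Y = B' + B m t ** D m t - D m t ** B m t - A m t ** C (Suc m) t + C m t ** A (m - 1) t"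
  define Z where "Z = C' + C m t ** D (m - 1) t - D m t ** C m t - B m t ** C m t + C m t ** B (m - 1) t"
  have rel: "X ** v (Suc m) j t + Y ** v m j t + Z ** v (m - 1) j t = 0" for j
    unfolding X_def Y_def Z_def by (rule lax_relation[OF A' B' C'])
  have "X ** v (Suc m) (Suc m) t = 0"
    using rel[of "Suc m"] by (simp add: v_vanish mat.zero_right)
  then have X: "X = 0" by (rule invertible_mult_eq_0[OF v_lead_invertible])
  \<comment> \<open>For \<open>m = 0\<close> the degree bound does not remove
    \<open>v (m - 1) m\<close>, which is the leading coefficient \<open>v 0 0\<close>. Here
    \<open>Z\<close> vanishes because \<open>C 0\<close> is identically zero.\<close>
  have Z_0: "Z = 0" if "m = 0"
  proof -
    have "C m = (\<lambda>t. 0)" using that C_0 by auto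
    then show ?thesis by (simp add: Z_def C'_def mat.zero_left mat.zero_right)
  qed
  have "Z ** v (m - 1) m t = 0"
    using Z_0 by (cases "m = 0") (simp_all add: v_vanish mat.zero_left mat.zero_right)
  then have "Y ** v m m t = 0"
    using rel[of m] by (simp add: X mat.zero_left)
  then have Y: "Y = 0" by (rule invertible_mult_eq_0[OF v_lead_invertible])
  have "Z ** v (m - 1) (m - 1) t = 0"
    using rel[of "m - 1"] by (simp add: X Y mat.zero_left)
  then have Z: "Z = 0" by (rule invertible_mult_eq_0[OF v_lead_invertible])
  have "A' = D m t ** A m t - A m t ** D (Suc m) t"
    using X unfolding X_def by (simp add: algebra_simps)
  then show "(A m has_vector_derivative D m t ** A m t - A m t ** D (Suc m) t) (at t)"
    using A' by simp
  have "B' = D m t ** B m t - B m t ** D m t + A m t ** C (Suc m) t - C m t ** A (m - 1) t"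
    using Y unfolding Y_def by (simp add: algebra_simps)
  then show "(B m has_vector_derivative D m t ** B m t - B m t ** D m t
      + A m t ** C (Suc m) t - C m t ** A (m - 1) t) (at t)"
    using B' by simp
  have "C' = D m t ** C m t - C m t ** D (m - 1) t + B m t ** C m t - C m t ** B (m - 1) t"
    using Z unfolding Z_def by (simp add: algebra_simps)
  then show "(C m has_vector_derivative D m t ** C m t - C m t ** D (m - 1) t
      + B m t ** C m t - C m t ** B (m - 1) t) (at t)"
    using C' by simp
qed

end

section \<open>Coefficients and moments of vector polynomials\<close>

lemma const_mat_mult_nth:
  "(const_mat X *v P) $ i = smult (X $ i $ 1) (P $ 1) + smult (X $ i $ 2) (P $ 2)"
  by (simp add: const_mat_def map_matrix_def matrix_vector_mult_def sum_2)

lemma beta_add: "beta (P + Q) j = beta P j + beta Q j"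
  by (simp add: cmat_eq_iff beta_def)

lemma beta_const_mat: "beta (const_mat X *v P) j = X ** beta P j"
  by (simp add: cmat_eq_iff beta_def const_mat_mult_nth cmat_mult_entry)

lemma beta_shift: "beta (monom 1 2 *s P) j = (case j of 0 \<Rightarrow> 0 | Suc i \<Rightarrow> beta P i)"
  by (cases j) (simp_all add: cmat_eq_iff beta_def coeff_monom_mult)

lemma monom_Pj: "monom 1 (2 * k) *s Pj j = Pj (j + k)"
  by (simp add: Pj_def mult_monom vec_eq_iff flip: mult.assoc) (simp add: add.commute)

lemma act_add:
  "vector_of_linear_functionals U \<Longrightarrow> act U (P + Q) = act U P + act U Q"
  by (simp add: vector_of_linear_functionals_def linear_functional_iff act_def vec_eq_iff)

lemma act_const_mat:
  "vector_of_linear_functionals U \<Longrightarrow> act U (const_mat X *v P) = X ** act U P"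
  by (simp add: vector_of_linear_functionals_def linear_functional_iff act_def cmat_eq_iff
      const_mat_mult_nth cmat_mult_entry)

lemma act_0: "vector_of_linear_functionals U \<Longrightarrow> act U 0 = 0"
  using act_add[of U 0 0] by simp

lemma act_sum:
  "vector_of_linear_functionals U \<Longrightarrow> act U (\<Sum>i\<in>I. P i) = (\<Sum>i\<in>I. act U (P i))"
  by (induction I rule: infinite_finite_induct) (simp_all add: act_0 act_add)

lemma monom_const_mat: "monom 1 k *s (const_mat X *v P) = const_mat X *v (monom 1 k *s P)"
  by (simp add: vec_eq_iff const_mat_mult_nth algebra_simps)

text \<open>Translates left-orthogonality into the moment sums of \<open>moment_flow\<close>:
  multiplication by \<open>x^(2k)\<close> shifts \<open>Pj j\<close> to
  \<open>Pj (j + k)\<close>.\<close>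

lemma act_xpow_eq_sum:
  assumes U: "vector_of_linear_functionals U" and vanish: "\<And>j. m < j \<Longrightarrow> beta P j = 0"
  shows "act (xpow_functional (2 * k) U) P = (\<Sum>j\<le>m. beta P j ** act U (Pj (j + k)))"
proof -
  have "P = (\<Sum>j | beta P j \<noteq> 0. const_mat (beta P j) *v Pj j)"
    by (rule beta_decomposition)
  also have "\<dots> = (\<Sum>j\<le>m. const_mat (beta P j) *v Pj j)"
  proof (rule sum.mono_neutral_left)
    show "{j. beta P j \<noteq> 0} \<subseteq> {..m}" using vanish not_le_imp_less by auto
  qed (simp_all add: vec_eq_iff const_mat_mult_nth)
  finally have P: "P = (\<Sum>j\<le>m. const_mat (beta P j) *v Pj j)" .
  have "monom 1 (2 * k) *s P = (\<Sum>j\<le>m. const_mat (beta P j) *v Pj (j + k))"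
    unfolding monom_Pj[symmetric] monom_const_mat[symmetric]
    by (subst P) (simp add: vec_eq_iff sum_distrib_left)
  then show ?thesis
    by (simp only: act_xpow_functional act_sum[OF U] act_const_mat[OF U])
qed

section \<open>Geometric growth along the block recurrence\<close>

lemma norm_cmat_le:
  fixes X :: cmat
  assumes "\<And>i j. norm (X $ i $ j) \<le> K"
  shows "norm X \<le> 4 * K"
proof -
  have "norm (X $ i) \<le> 2 * K" for i
    using L2_set_le_sum[of UNIV "\<lambda>j. norm (X $ i $ j)"] assms[of i 1] assms[of i 2]
    by (simp add: norm_vec_def[of "X $ i"] sum_2)
  from this[of 1] this[of 2] show ?thesis
    using L2_set_le_sum[of UNIV "\<lambda>i. norm (X $ i)"]
    by (simp add: norm_vec_def[of X] sum_2)
qed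

text \<open>Raising \<open>k\<close> by one costs three products, each contributing a factor
  \<open>K * Q\<close>, so \<open>R = 3 * K * Q\<close> works uniformly in \<open>m\<close>. At
  \<open>k = 0\<close> only \<open>F 0 0\<close> is nonzero.\<close>

lemma block_recurrence_growth:
  fixes F :: "nat \<Rightarrow> nat \<Rightarrow> cmat" and A B C :: "nat \<Rightarrow> cmat"
  assumes rec: "\<And>m k. F m (Suc k) = A m ** F (Suc m) k + B m ** F m k + C m ** F (m - 1) k"
    and init: "\<And>m. F (Suc m) 0 = 0"
    and bounds: "\<And>m. norm (A m) \<le> K" "\<And>m. norm (B m) \<le> K" "\<And>m. norm (C m) \<le> K"
  shows "\<exists>R. \<forall>m k. norm (F m k) \<le> norm (F 0 0) * R ^ k"
proof -
  obtain Q where "0 \<le> Q" and Q: "\<And>(X :: cmat) (Y :: cmat). norm (X ** Y) \<le> norm X * norm Y * Q"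
    using mat.nonneg_bounded by blast
  have "0 \<le> K" using bounds(1)[of 0] norm_ge_zero order_trans by blast
  have step: "norm (X ** Y) \<le> K * y * Q" if "norm X \<le> K" "norm Y \<le> y" for X Y :: cmat and y
    using Q[of X Y] that \<open>0 \<le> Q\<close> \<open>0 \<le> K\<close>
    by (meson mult_mono mult_right_mono norm_ge_zero order_trans)
  have "norm (F m k) \<le> norm (F 0 0) * (3 * K * Q) ^ k" for m k
  proof (induction k arbitrary: m)
    case 0
    then show ?case by (cases m) (simp_all add: init)
  next
    case (Suc k)
    have "norm (F m (Suc k)) \<le>
        norm (A m ** F (Suc m) k) + norm (B m ** F m k) + norm (C m ** F (m - 1) k)"
      unfolding rec by (meson add_right_mono norm_triangle_ineq order_trans)
    also have "\<dots> \<le> 3 * (K * (norm (F 0 0) * (3 * K * Q) ^ k) * Q)"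
      using step[OF bounds(1) Suc.IH, of m "Suc m"] step[OF bounds(2) Suc.IH, of m m]
        step[OF bounds(3) Suc.IH, of m "m - 1"] by simp
    finally show ?case by (simp add: algebra_simps)
  qed
  then show ?thesis by blast
qed

theorem theorem4:
  fixes a b c d :: "int \<Rightarrow> real \<Rightarrow> complex"
    and \<B> :: "real \<Rightarrow> int \<Rightarrow> vpoly"
    and U :: "real \<Rightarrow> vfunctional"
  assumes differentiable:
      "\<And>n t. n \<ge> 1 \<Longrightarrow> a n differentiable (at t) \<and> b n differentiable (at t) \<and>
                      c n differentiable (at t) \<and> d n differentiable (at t)"
    and a1_real: "\<And>t. a 1 t \<in> \<real>"
    and zero: "\<And>t. a 0 t = 0 \<and> b 0 t = 0 \<and> c 0 t = 0 \<and> d 0 t = 0"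
    and minus_one: "\<And>t. c (-1) t = 0 \<and> d (-1) t = 0"
    and d_nonzero: "\<And>n t. n \<ge> 1 \<Longrightarrow> d n t \<noteq> 0"
    and vpolys: "\<And>t. vector_polynomials a b c d t (\<B> t)"
    and functionals: "\<And>t. vector_of_linear_functionals (U t)"
    and normal: "\<And>t. normalized (U t)"
    and orthogonal: "\<And>t. left_orthogonal c d t (\<B> t) (U t)"
    and bounded: "\<exists>K>0. \<forall>n\<ge>1. \<forall>t. Max {norm (a n t), norm (b n t), norm (c n t), norm (d n t)} \<le> K"
    and a1_deriv: "\<And>t. (a 1 has_vector_derivative c 1 t) (at t)"
    and exp_rep: "\<And>t. \<exists>E :: cmat. \<forall>P. act (U t) P = exp_functional_act t (U 0) P ** E"
  shows "\<forall>n\<ge>1. \<forall>t.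
      (a n has_vector_derivative (c n t - c (n-2) t)) (at t) \<and>
      (b n has_vector_derivative
         (c n t * a (n+1) t - c (n-1) t * a n t + d n t - d (n-2) t)) (at t) \<and>
      (c n has_vector_derivative
         (c n t * (b (n+1) t - b n t) + d n t * a (n+2) t - d (n-1) t * a n t)) (at t) \<and>
      (d n has_vector_derivative (d n t * (b (n+2) t - b n t))) (at t)"
proof -

  \<comment> \<open>The block recurrence over natural indices\<close>
  define A where "A = (\<lambda>m t. A_mat a t (int m))"
  define Ai :: "nat \<Rightarrow> real \<Rightarrow> cmat"
    where "Ai = (\<lambda>m t. vector [vector [1, 0], vector [- a (2 * int m + 3) t, 1]])"
  define B where "B = (\<lambda>m t. B_mat a b c t (int m))"
  define C where "C = (\<lambda>m t. C_mat c d t (int m))"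
  \<comment> \<open>\<open>L\<close> is the coefficient of the initial polynomial at
    \<open>Pj 0\<close>, and \<open>Li\<close> is its inverse.\<close>
  define L :: "real \<Rightarrow> cmat" where "L = (\<lambda>t. vector [vector [1, 0], vector [- a 1 t, 1]])"
  define Li :: "real \<Rightarrow> cmat" where "Li = (\<lambda>t. vector [vector [1, 0], vector [a 1 t, 1]])"
  define v where "v = (\<lambda>m j t. beta (\<B> t (int m)) j)"
  define M where "M = (\<lambda>j t. act (U t) (Pj j))"

  \<comment> \<open>The entries of \<open>C 0\<close> have indices -1 and 0, outside the range of
    the differentiability and boundedness assumptions; the boundary conventions cover them.\<close>
  have cd_zero: "c n t = 0" "d n t = 0" if "-1 \<le> n" "n < 1" for n t
  proof -
    have "n = -1 \<or> n = 0" using that by auto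
    then show "c n t = 0" "d n t = 0" using zero minus_one by auto
  qed
  have cd_diff: "c n differentiable (at t)" "d n differentiable (at t)" if "-1 \<le> n" for n t
  proof -
    have "c n differentiable (at t) \<and> d n differentiable (at t)"
    proof (cases "n < 1")
      case True
      then have "c n = (\<lambda>t. 0)" "d n = (\<lambda>t. 0)" using cd_zero that by auto
      then show ?thesis by simp
    qed (use differentiable[of n t] in auto)
    then show "c n differentiable (at t)" "d n differentiable (at t)" by auto
  qed
  have L_Li: "L t ** Li t = mat 1" and Li_L: "Li t ** L t = mat 1" for t
    by (simp_all add: cmat_eq_iff cmat_mult_entry L_def Li_def mat_def)
  have C_0: "C 0 t = 0" for t
    using zero[of t] minus_one[of t] by (simp add: C_def C_mat_def cmat_eq_iff)
  have \<B>_rec: "monom 1 2 *s \<B> t (int m) = const_mat (A m t) *v \<B> t (int (Suc m))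
      + const_mat (B m t) *v \<B> t (int m) + const_mat (C m t) *v \<B> t (int (m - 1))" for m t
  proof -
    have "const_mat (C m t) *v \<B> t (int m - 1) = const_mat (C m t) *v \<B> t (int (m - 1))"
      by (cases m) (auto simp: C_0 vec_eq_iff const_mat_mult_nth)
    moreover have "monom 1 2 *s \<B> t (int m) = const_mat (A m t) *v \<B> t (int m + 1)
      + const_mat (B m t) *v \<B> t (int m) + const_mat (C m t) *v \<B> t (int m - 1)"
      using vpolys[of t] by (simp add: vector_polynomials_def A_def B_def C_def)
    ultimately show ?thesis by (simp add: add.commute)
  qed
  have v_0_0_eq: "v 0 0 = L"
    using vpolys by (auto simp: fun_eq_iff v_def L_def vector_polynomials_def beta_def cmat_eq_iff)
  have v_0_Suc: "v 0 (Suc j) t = 0" for j t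
    using vpolys[of t] by (simp add: v_def vector_polynomials_def beta_def cmat_eq_iff coeff_pCons)
  have L_diff: "L differentiable (at t)" and Li_diff: "Li differentiable (at t)"
    and A_diff: "A m differentiable (at t)" and Ai_diff: "Ai m differentiable (at t)"
    and B_diff: "B m differentiable (at t)" and C_diff: "C m differentiable (at t)" for m t
  proof -
    show "L differentiable (at t)" "Li differentiable (at t)" "A m differentiable (at t)"
      "Ai m differentiable (at t)" "B m differentiable (at t)" "C m differentiable (at t)"
      by (rule cmat_differentiable; simp add: L_def Li_def A_def A_mat_def Ai_def B_def B_mat_def
          C_def C_mat_def differentiable cd_diff)+
  qed
  interpret block_recurrence A Ai B C v
  proof
    show "(case j of 0 \<Rightarrow> 0 | Suc i \<Rightarrow> v m i t) =
      A m t ** v (Suc m) j t + B m t ** v m j t + C m t ** v (m - 1) j t" for j m t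
      unfolding v_def beta_shift[symmetric] \<B>_rec by (simp only: beta_add beta_const_mat)
    show "Ai m t ** A m t = mat 1" for m t
      by (simp add: cmat_eq_iff cmat_mult_entry A_def A_mat_def Ai_def mat_def)
    show "invertible (v 0 0 t)" for t
      unfolding v_0_0_eq invertible_def using L_Li Li_L by blast
    show "v 0 0 differentiable (at t)" for t
      unfolding v_0_0_eq by (rule L_diff)
  qed (fact A_diff Ai_diff B_diff C_diff C_0 v_0_Suc)+

  \<comment> \<open>Moments of the vector polynomials\<close>
  have "\<forall>t. \<exists>\<Delta>0. invertible \<Delta>0 \<and> (\<forall>m. \<forall>k\<le>m. act (xpow_functional (2*k) (U t)) (\<B> t (int m)) =
      (if k = m then Delta c d t \<Delta>0 m else 0))"
    using orthogonal unfolding left_orthogonal_def by blast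
  then obtain \<Delta>0 where \<Delta>0: "\<And>t. invertible (\<Delta>0 t)"
    and act_\<B>: "\<And>t m k. k \<le> m \<Longrightarrow> act (xpow_functional (2*k) (U t)) (\<B> t (int m)) =
      (if k = m then Delta c d t (\<Delta>0 t) m else 0)"
    unfolding choice_iff by blast
  define \<Delta> where "\<Delta> = (\<lambda>m t. Delta c d t (\<Delta>0 t) m)"

  \<comment> \<open>\<open>F_rec\<close> raises \<open>k\<close> using only the blocks, and
    \<open>M_F\<close> recovers the moments from \<open>F 0\<close>. Regularity and bounds thus pass
    from the coefficients to the moments.\<close>
  define F where "F = (\<lambda>m k t. act (xpow_functional (2*k) (U t)) (\<B> t (int m)))"
  have F_sum: "F m k t = (\<Sum>j\<le>m. v m j t ** M (j + k) t)" for m k t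
    unfolding F_def v_def M_def
    by (rule act_xpow_eq_sum[OF functionals]) (use v_vanish in \<open>simp add: v_def\<close>)
  have F_rec: "F m (Suc k) t = A m t ** F (Suc m) k t + B m t ** F m k t + C m t ** F (m - 1) k t"
    for m k t
  proof -
    have "F m (Suc k) t = act (xpow_functional (2*k) (U t)) (monom 1 2 *s \<B> t (int m))"
      by (simp add: F_def act_xpow_functional vector_smult_assoc mult_monom)
    then show ?thesis
      unfolding \<B>_rec
      by (simp only: F_def act_xpow_functional vector_add_ldistrib monom_const_mat
          act_add[OF functionals] act_const_mat[OF functionals])
  qed
  have M_0: "M 0 t = mat 1" for t
    using normal[of t] by (simp add: M_def Pj_def normalized_def)
  have F_0: "F 0 k t = L t ** M k t" for k t
    by (simp add: F_sum v_0_0_eq)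
  have F_Suc_0: "F (Suc m) 0 t = 0" for m t
    using act_\<B>[of 0 "Suc m" t] by (simp add: F_def)
  have M_F: "M k t = Li t ** F 0 k t" for k t
    by (simp add: F_0 matrix_mul_assoc Li_L)

  \<comment> \<open>Differentiability and growth of the moments\<close>
  have F_diff: "F m k differentiable (at t)" for m k t
  proof (induction k arbitrary: m)
    case 0
    show ?case
    proof (cases m)
      case 0
      then have "F m 0 = L" by (auto simp: F_0 M_0)
      then show ?thesis using L_diff by simp
    next
      case (Suc n)
      then have "F m 0 = (\<lambda>t. 0)" by (auto simp: F_Suc_0)
      then show ?thesis by simp
    qed
  next
    case (Suc k)
    have "F m (Suc k) = (\<lambda>t. A m t ** F (Suc m) k t + B m t ** F m k t + C m t ** F (m - 1) k t)"
      by (auto simp: F_rec)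
    then show ?case
      by (simp only:) (intro differentiable_add cmat_differentiable_mult A_diff B_diff C_diff Suc.IH)
  qed
  have M_diff: "M k differentiable (at t)" for k t
  proof -
    have "M k = (\<lambda>t. Li t ** F 0 k t)" by (auto simp only: M_F)
    then show ?thesis by (simp only:) (intro cmat_differentiable_mult Li_diff F_diff)
  qed

  have M_growth: "\<exists>N R. \<forall>k. norm (M k 0) \<le> N * R ^ k"
  proof -
    obtain K where K: "K > 0" "\<And>n. n \<ge> 1 \<Longrightarrow>
        norm (a n 0) \<le> K \<and> norm (b n 0) \<le> K \<and> norm (c n 0) \<le> K \<and> norm (d n 0) \<le> K"
      using bounded by auto
    \<comment> \<open>The bound \<open>K + 1\<close> also dominates the constant entries 1 of
      \<open>A m\<close>.\<close>
    have cd_bound: "norm (c n 0) \<le> K + 1" "norm (d n 0) \<le> K + 1" if "-1 \<le> n" for n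
      using K(1) K(2)[of n] cd_zero[of n 0] that by (cases "n < 1"; force)+
    have ab_bound: "norm (a n 0) \<le> K + 1" "norm (b n 0) \<le> K + 1" if "1 \<le> n" for n
      using K(2)[OF that] by auto
    have two: "i = 1 \<or> i = 2" for i :: 2 by (rule exhaust_2)
    have "norm (A m 0 $ i $ j) \<le> K + 1" for m i j
      using two[of i] two[of j] K(1) ab_bound by (auto simp: A_def A_mat_def)
    then have A_bound: "norm (A m 0) \<le> 4 * (K + 1)" for m by (rule norm_cmat_le)
    have "norm (B m 0 $ i $ j) \<le> K + 1" for m i j
      using two[of i] two[of j] K(1) ab_bound cd_bound by (auto simp: B_def B_mat_def)
    then have B_bound: "norm (B m 0) \<le> 4 * (K + 1)" for m by (rule norm_cmat_le)
    have "norm (C m 0 $ i $ j) \<le> K + 1" for m i j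
      using two[of i] two[of j] K(1) cd_bound by (auto simp: C_def C_mat_def)
    then have C_bound: "norm (C m 0) \<le> 4 * (K + 1)" for m by (rule norm_cmat_le)
    obtain R where R: "\<And>m k. norm (F m k 0) \<le> norm (F 0 0 0) * R ^ k"
      using block_recurrence_growth[where F = "\<lambda>m k. F m k 0", OF F_rec F_Suc_0 A_bound B_bound C_bound]
      by blast
    obtain Q where "0 \<le> Q" and Q: "\<And>(X :: cmat) (Y :: cmat). norm (X ** Y) \<le> norm X * norm Y * Q"
      using mat.nonneg_bounded by blast
    have "norm (M k 0) \<le> (norm (Li 0) * norm (F 0 0 0) * Q) * R ^ k" for k
    proof -
      have "norm (M k 0) \<le> norm (Li 0) * norm (F 0 k 0) * Q" unfolding M_F by (rule Q)
      also have "\<dots> \<le> norm (Li 0) * (norm (F 0 0 0) * R ^ k) * Q"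
        using R[of 0 k] \<open>0 \<le> Q\<close> by (intro mult_right_mono mult_left_mono) auto
      finally show ?thesis by (simp add: mult_ac)
    qed
    then show ?thesis by blast
  qed
  then obtain N R where growth: "\<And>k. norm (M k 0) \<le> N * R ^ k" by blast
  have M_exp: "\<exists>E. \<forall>j. M j t = (\<Sum>k. (t ^ k / fact k) *\<^sub>R M (j + k) 0) ** E" for t
  proof -
    obtain E where E: "\<And>P. act (U t) P = exp_functional_act t (U 0) P ** E"
      using exp_rep[of t] by blast
    have "M j t = (\<Sum>k. (t ^ k / fact k) *\<^sub>R M (j + k) 0) ** E" for j
      unfolding M_def E exp_functional_act_Pj by (simp only: Pj_def)
    then show ?thesis by blast
  qed

  interpret moment_flow A Ai B C v M \<Delta>
  proof
    show "(M j has_vector_derivative M (Suc j) t - M j t ** M 1 t) (at t)" for j t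
      by (rule moments_has_vector_derivative[OF growth M_diff M_0 M_exp])
    show "(\<Sum>j\<le>m. v m j t ** M (j + k) t) = (if k = m then \<Delta> m t else 0)" if "k \<le> m" for k m t
      unfolding F_sum[symmetric] F_def \<Delta>_def by (rule act_\<B>[OF that])
    show "invertible (\<Delta> 0 t)" for t
      using \<Delta>0 by (simp add: \<Delta>_def)
    show "\<Delta> (Suc m) t = C (Suc m) t ** \<Delta> m t" for m t
      by (simp add: \<Delta>_def C_def)
    show "invertible (C (Suc m) t)" for m t
      using d_nonzero by (simp add: invertible_det_nz det_2 C_def C_mat_def)
  qed

  have lax_entry: "((\<lambda>t. X t $ i $ j) has_vector_derivative X' $ i $ j) (at t)"
    if "(X has_vector_derivative X') (at t)" for X :: "real \<Rightarrow> cmat" and X' i j t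
    using that by (intro has_vector_derivative_vec_nth)
  have entry_eq: "X' $ i $ j = 0"
    if "(X has_vector_derivative X') (at t)" "\<And>s. X s $ i $ j = z"
    for X :: "real \<Rightarrow> cmat" and X' i j t z
    using lax_entry[OF that(1), of i j] that(2) vector_derivative_unique_at[OF _ has_vector_derivative_const]
    by auto

  have D: "D m t $ 1 $ 1 = 0 \<and> D m t $ 1 $ 2 = 0 \<and> D m t $ 2 $ 1 = - c (2 * int m + 1) t \<and> D m t $ 2 $ 2 = 0"
    for m t
  proof (induction m)
    case 0
    have "(L has_vector_derivative vector [vector [0, 0], vector [- c 1 t, 0]]) (at t)"
      (is "(_ has_vector_derivative ?L') _")
    proof (intro has_vector_derivative_vec)
      fix i j :: 2
      show "((\<lambda>t. L t $ i $ j) has_vector_derivative ?L' $ i $ j) (at t)"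
        using exhaust_2[of i] exhaust_2[of j] has_vector_derivative_minus[OF a1_deriv]
        by (auto simp: L_def)
    qed
    then have "D 0 t ** L t = ?L'"
      using D_v_lead[of 0 t] by (simp add: v_0_0_eq vector_derivative_at)
    then have "D 0 t = ?L' ** Li t"
      by (metis L_Li matrix_mul_assoc matrix_mul_rid)
    then show ?case by (simp add: cmat_mult_entry Li_def)
  next
    case (Suc m)
    \<comment> \<open>All entries of \<open>A m\<close> except (2,1) are constant in time. The
      corresponding Lax entries vanish and give three entries of \<open>D (Suc m)\<close>.\<close>
    have "(D m t ** A m t - A m t ** D (Suc m) t) $ 1 $ 1 = 0"
      by (rule entry_eq[OF A_lax]) (simp add: A_def A_mat_def)
    then have 11: "D (Suc m) t $ 1 $ 1 = 0"
      by (simp add: cmat_mult_entry A_def A_mat_def Suc)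
    have "(D m t ** A m t - A m t ** D (Suc m) t) $ 1 $ 2 = 0"
      by (rule entry_eq[OF A_lax]) (simp add: A_def A_mat_def)
    then have 12: "D (Suc m) t $ 1 $ 2 = 0"
      by (simp add: cmat_mult_entry A_def A_mat_def Suc)
    have "(D m t ** A m t - A m t ** D (Suc m) t) $ 2 $ 2 = 0"
      by (rule entry_eq[OF A_lax]) (simp add: A_def A_mat_def)
    then have 22: "D (Suc m) t $ 2 $ 2 = 0"
      by (simp add: cmat_mult_entry A_def A_mat_def Suc 12)
    \<comment> \<open>By the induction hypothesis the two terms with
      \<open>d (2 * int m + 2) t * c (2 * int m + 1) t\<close> cancel, so the nonzero factor
      \<open>d (2 * int m + 1) t\<close> can be split off.\<close>
    have "(D (Suc m) t ** C (Suc m) t - C (Suc m) t ** D m t + B (Suc m) t ** C (Suc m) t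
        - C (Suc m) t ** B m t) $ 2 $ 1 = 0"
      by (rule entry_eq[OF C_lax[where m = "Suc m", simplified]]) (simp add: C_def C_mat_def)
    then have "d (2 * int m + 1) t * (D (Suc m) t $ 2 $ 1 + c (2 * int (Suc m) + 1) t) = 0"
      by (simp add: cmat_mult_entry B_def B_mat_def C_def C_mat_def Suc 22 algebra_simps)
    then have "D (Suc m) t $ 2 $ 1 = - c (2 * int (Suc m) + 1) t"
      using d_nonzero[of "2 * int m + 1" t] by (simp add: eq_neg_iff_add_eq_0)
    with 11 12 22 show ?case by simp
  qed

  \<comment> \<open>The integer index \<open>int m - 1\<close> brings in
    \<open>a (2 * int m + 1)\<close> uniformly, including \<open>a 1\<close> for
    \<open>m = 0\<close>, where both products are zero.\<close>
  have C_A: "C m t ** A (m - 1) t = C_mat c d t (int m) ** A_mat a t (int m - 1)" for m t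
  proof (cases m)
    case 0
    then show ?thesis using C_0[of t] by (simp add: C_def mat.zero_left)
  qed (simp add: C_def A_def)

  \<comment> \<open>The scalar system, read off from the matrix entries\<close>
  note entries = A_def B_def C_def A_mat_def B_mat_def C_mat_def cmat_mult_entry D
  have A_21: "(a (2 * int m + 3) has_vector_derivative c (2 * int m + 3) t - c (2 * int m + 1) t) (at t)"
    for m t
    using lax_entry[OF A_lax[of m t], where i = 2 and j = 1] by (simp add: entries add.commute)
  have B_eqs:
    "(b (2 * int m + 1) has_vector_derivative c (2 * int m + 1) t * a (2 * int m + 2) t
      - c (2 * int m) t * a (2 * int m + 1) t + d (2 * int m + 1) t - d (2 * int m - 1) t) (at t)"
    "(a (2 * int m + 2) has_vector_derivative c (2 * int m + 2) t - c (2 * int m) t) (at t)"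
    "(c (2 * int m + 1) has_vector_derivative
      c (2 * int m + 1) t * (b (2 * int m + 2) t - b (2 * int m + 1) t)
      + d (2 * int m + 1) t * a (2 * int m + 3) t - d (2 * int m) t * a (2 * int m + 1) t) (at t)"
    "(b (2 * int m + 2) has_vector_derivative c (2 * int m + 2) t * a (2 * int m + 3) t
      - c (2 * int m + 1) t * a (2 * int m + 2) t + d (2 * int m + 2) t - d (2 * int m) t) (at t)"
    for m t
    using B_lax[of m t, unfolded C_A, THEN lax_entry, where i = 1 and j = 1]
      B_lax[of m t, unfolded C_A, THEN lax_entry, where i = 1 and j = 2]
      B_lax[of m t, unfolded C_A, THEN lax_entry, where i = 2 and j = 1]
      B_lax[of m t, unfolded C_A, THEN lax_entry, where i = 2 and j = 2]
    by (simp_all add: entries algebra_simps)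
  \<comment> \<open>The index starts at \<open>Suc m\<close>, since \<open>C 0\<close> is
    identically zero and carries no equation.\<close>
  have C_eqs:
    "(d (2 * int m + 1) has_vector_derivative
      d (2 * int m + 1) t * (b (2 * int m + 3) t - b (2 * int m + 1) t)) (at t)"
    "(c (2 * int m + 2) has_vector_derivative
      c (2 * int m + 2) t * (b (2 * int m + 3) t - b (2 * int m + 2) t)
      + d (2 * int m + 2) t * a (2 * int m + 4) t - d (2 * int m + 1) t * a (2 * int m + 2) t) (at t)"
    "(d (2 * int m + 2) has_vector_derivative
      d (2 * int m + 2) t * (b (2 * int m + 4) t - b (2 * int m + 2) t)) (at t)"
    for m t
    using C_lax[of "Suc m" t, simplified, THEN lax_entry, where i = 1 and j = 1]
      C_lax[of "Suc m" t, simplified, THEN lax_entry, where i = 1 and j = 2]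
      C_lax[of "Suc m" t, simplified, THEN lax_entry, where i = 2 and j = 2]
    by (simp_all add: entries algebra_simps)

  show ?thesis
  proof (intro allI impI)
    fix n :: int and t assume "n \<ge> 1"
    then obtain m where "(n - 1) div 2 = int m"
      using nonneg_int_cases[of "(n - 1) div 2"] by auto
    moreover have "n = 2 * ((n - 1) div 2) + 1 \<or> n = 2 * ((n - 1) div 2) + 2" by presburger
    ultimately have m: "n = 2 * int m + 1 \<or> n = 2 * int m + 2" by simp
    show "(a n has_vector_derivative (c n t - c (n-2) t)) (at t) \<and>
      (b n has_vector_derivative
         (c n t * a (n+1) t - c (n-1) t * a n t + d n t - d (n-2) t)) (at t) \<and>
      (c n has_vector_derivative
         (c n t * (b (n+1) t - b n t) + d n t * a (n+2) t - d (n-1) t * a n t)) (at t) \<and>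
      (d n has_vector_derivative (d n t * (b (n+2) t - b n t))) (at t)"
      using m
    proof
      assume n: "n = 2 * int m + 1"
      \<comment> \<open>The blocks \<open>A m\<close> contain the odd-indexed \<open>a\<close> only
        from \<open>a 3\<close> on; for \<open>a 1\<close> the hypothesis is used together with
        \<open>c (-1) = 0\<close>.\<close>
      have "(a n has_vector_derivative (c n t - c (n-2) t)) (at t)"
      proof (cases m)
        case 0
        then show ?thesis using a1_deriv[of t] minus_one[of t] by (simp add: n)
      next
        case (Suc k)
        then show ?thesis using A_21[of k t] by (simp add: n add.commute)
      qed
      then show ?thesis
        using B_eqs(1,3)[of m t] C_eqs(1)[of m t] by (simp add: n add.commute)
    next
      assume n: "n = 2 * int m + 2"
      show ?thesis
        using B_eqs(2,4)[of m t] C_eqs(2,3)[of m t] by (simp add: n add.commute)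
    qed
  qed
qed

end
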